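(* For integers $n\ge k\ge 0$, let $\mathcal{P}_a(n,k)$ be the set of grounded partitions in $\mathcal{P}_{2,a}$ of weight $n$ having exactly $k$ odd parts, and let $\mathcal{E}(n,k)$ be the set of (ordinary) partitions of $n$ having exactly $k$ odd parts (counted with multiplicity) and in which all even parts are distinct. Then there is a bijection between $\mathcal{P}_a(n,k)$ and $\mathcal{E}(n,k)$; in particular $|\mathcal{P}_a(n,k)|=|\mathcal{E}(n,k)|$.
   Context: Colours are $a,b,c$ (indexed $c_0=a$, $c_1=b$, $c_2=c$). A grounded partition in $\mathcal{P}_{2,a}$ is a finite (possibly empty) sequence $(\lambda_1,\dots,\lambda_\ell)$ of positive integers, each carrying a colour in $\{a,b,c\}$, such that, setting $\lambda_0=0$ with colour $a$ (the ground), for every $0\le j<\ell$, if $\lambda_j$ has colour $c_p$ and $\lambda_{j+1}$ has colour $c_r$, then $\lambda_{j+1}-\lambda_j=|2-p-r|$. (Thus the required differences are: $a\to a$: 2, $a\to b$: 1, $a\to c$: 0, $b\to a$: 1, $b\to b$: 0, $b\to c$: 1, $c\to a$: 0, $c\to b$: 1, $c\to c$: 2.) Its weight is $\lambda_1+\cdots+\lambda_\ell$, and odd parts are counted with multiplicity. *)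

theory Defs
  imports "HOL-Library.Multiset"
begin

datatype colour = Col_a | Col_b | Col_c

text \<open>The index \<open>p\<close> of the colour \<open>c\<^sub>p\<close>.\<close>

primrec colour_index :: "colour \<Rightarrow> int" where
  "colour_index Col_a = 0"
| "colour_index Col_b = 1"
| "colour_index Col_c = 2"

text \<open>
  Coloured parts are pairs of a size and a colour. A grounded partition is the list
  \<open>[\<lambda>\<^sub>1, \<dots>, \<lambda>\<^sub>\<ell>]\<close>, without its ground \<open>\<lambda>\<^sub>0 = (0, Col_a)\<close>; in the definition below, \<open>qs ! j\<close>
  is \<open>\<lambda>\<^sub>j\<close> for \<open>0 \<le> j \<le> \<ell>\<close>. Differences are taken in the integers.
\<close>

definition grounded_partition :: "(nat \<times> colour) list \<Rightarrow> bool" where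
  "grounded_partition ps \<longleftrightarrow>
     (\<forall>x\<in>set ps. 0 < fst x) \<and>
     (let qs = (0, Col_a) # ps in
      \<forall>j<length ps.
        int (fst (qs ! Suc j)) - int (fst (qs ! j)) =
          \<bar>2 - colour_index (snd (qs ! j)) - colour_index (snd (qs ! Suc j))\<bar>)"

definition weight :: "(nat \<times> colour) list \<Rightarrow> nat" where
  "weight ps = sum_list (map fst ps)"

definition num_odd_parts :: "(nat \<times> colour) list \<Rightarrow> nat" where
  "num_odd_parts ps = length (filter (\<lambda>x. odd (fst x)) ps)"

definition P_a :: "nat \<Rightarrow> nat \<Rightarrow> (nat \<times> colour) list set" where
  "P_a n k = {ps. grounded_partition ps \<and> weight ps = n \<and> num_odd_parts ps = k}"

text \<open>An ordinary partition of \<open>n\<close> is the multiset of its parts.\<close>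

definition is_partition :: "nat \<Rightarrow> nat multiset \<Rightarrow> bool" where
  "is_partition n M \<longleftrightarrow> (\<forall>i\<in>#M. 0 < i) \<and> sum_mset M = n"

definition E_set :: "nat \<Rightarrow> nat \<Rightarrow> nat multiset set" where
  "E_set n k = {M. is_partition n M \<and> size (filter_mset odd M) = k \<and>
                   (\<forall>i\<in>#M. even i \<longrightarrow> count M i = 1)}"

end

theory Submission
  imports Defs "HOL-Library.Equipollence"
begin

text \<open>
  Even sizes carry the colours \<open>a\<close> and \<open>c\<close>, odd sizes the colour \<open>b\<close>. A grounded partition is therefore
  its multiset of sizes, whose even parts are \<open>2, 4, \<dots>, 2 M\<close> with multiplicities and whose odd parts
  are at most \<open>2 M + 1\<close>, together with one free binary choice (a mark) for every odd size
  below \<open>2 M\<close> that occurs. Let \<open>p(n, k)\<close> count these objects. Then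
  \<open>p(n, k) = p(n - 1, k - 1) + p(n - 2 k, k)\<close> for \<open>k > 0\<close>: the first term inserts a part \<open>1\<close>, and the
  second is the map \<open>exchange\<close> below, found as the combinatorial form of a telescoping proof of
  the \<open>q\<close>-Gauss sum. Partitions with distinct even parts satisfy the same recurrence: remove a part \<open>1\<close>,
  or else subtract \<open>2\<close> from every odd part. For \<open>k = 0\<close>, conjugation turns gap-free partitions into
  partitions with distinct parts.
\<close>

section \<open>Gap-free partitions and partitions into distinct parts\<close>

definition gapfree :: "nat \<Rightarrow> nat \<Rightarrow> nat multiset set" where
  "gapfree M h = {E. set_mset E = {1..M} \<and> sum_mset E = h}"

definition distinct_parts :: "nat \<Rightarrow> nat \<Rightarrow> nat set set" where
  "distinct_parts M h = {D. finite D \<and> 0 \<notin> D \<and> card D = M \<and> \<Sum>D = h}"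

text \<open>One copy of the largest part is removed. If other copies remain, the support is
  unchanged; otherwise it shrinks to \<open>{1..M}\<close>.\<close>

lemma gapfree_rec:
  "gapfree (Suc M) (h + Suc M) = add_mset (Suc M) ` (gapfree (Suc M) h \<union> gapfree M h)"
proof (intro equalityI subsetI)
  fix E assume E: "E \<in> gapfree (Suc M) (h + Suc M)"
  then have "Suc M \<in># E" by (auto simp: gapfree_def)
  then obtain F where F: "E = add_mset (Suc M) F" by (metis insert_DiffM)
  then have ins: "insert (Suc M) (set_mset F) = insert (Suc M) {1..M}"
    using E by (simp add: gapfree_def atLeastAtMostSuc_conv)
  have "set_mset F = {1..Suc M} \<or> set_mset F = {1..M}"
  proof (cases "Suc M \<in># F")
    case True
    then show ?thesis using ins by (simp add: insert_absorb atLeastAtMostSuc_conv)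
  next
    case False
    then show ?thesis using ins insert_ident[of "Suc M" "set_mset F" "{1..M}"] by simp
  qed
  then show "E \<in> add_mset (Suc M) ` (gapfree (Suc M) h \<union> gapfree M h)"
    using E F by (auto simp: gapfree_def)
next
  fix E assume "E \<in> add_mset (Suc M) ` (gapfree (Suc M) h \<union> gapfree M h)"
  then obtain F where "E = add_mset (Suc M) F" "F \<in> gapfree (Suc M) h \<union> gapfree M h" by blast
  then show "E \<in> gapfree (Suc M) (h + Suc M)"
    by (auto simp: gapfree_def atLeastAtMostSuc_conv)
qed

lemma Suc_vimage: "Suc ` (Suc -` S) = S - {0}"
proof -
  have "x \<in> range Suc \<longleftrightarrow> x \<noteq> 0" for x by (cases x) auto
  then show ?thesis by auto
qed

text \<open>Lowering each of the \<open>Suc M\<close> parts by 1 costs \<open>Suc M\<close> in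
  weight; a part 1 disappears and leaves one part fewer. Under conjugation this matches
  \<open>gapfree_rec\<close>.\<close>

lemma distinct_parts_rec:
  "distinct_parts (Suc M) (h + Suc M) =
     (`) Suc ` distinct_parts (Suc M) h \<union> (\<lambda>D. insert 1 (Suc ` D)) ` distinct_parts M h"
proof (intro equalityI subsetI)
  fix D assume D: "D \<in> distinct_parts (Suc M) (h + Suc M)"
  \<comment> \<open>\<open>C\<close> is \<open>D\<close> lowered by 1; deleting 0 discards what
    becomes of a part 1.\<close>
  define C where "C = Suc -` D - {0}"
  have fin: "finite C" "0 \<notin> C" using D by (auto simp: C_def distinct_parts_def intro: finite_vimageI)
  have SC: "Suc ` C = D - {1}"
    using D unfolding C_def image_set_diff[OF inj_Suc] Suc_vimage by (auto simp: distinct_parts_def)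
  have sC: "\<Sum>(Suc ` C) = \<Sum>C + card C"
    by (subst sum.reindex) (auto simp: sum_Suc)
  have cC: "card (Suc ` C) = card C" by (simp add: card_image)
  show "D \<in> (`) Suc ` distinct_parts (Suc M) h \<union> (\<lambda>D. insert 1 (Suc ` D)) ` distinct_parts M h"
  proof (cases "1 \<in> D")
    case True
    have eq: "D = insert 1 (Suc ` C)"
      using True SC by auto
    have "card D = Suc (card C)" "\<Sum>D = 1 + \<Sum>C + card C"
      unfolding eq using fin sC cC by (auto simp: card_insert_if image_iff)
    then have "C \<in> distinct_parts M h" using D fin by (auto simp: distinct_parts_def)
    then show ?thesis using eq by blast
  next
    case False
    have eq: "D = Suc ` C"
      using False SC by auto
    have "card D = card C" "\<Sum>D = \<Sum>C + card C"
      unfolding eq using sC cC by auto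
    then have "C \<in> distinct_parts (Suc M) h" using D fin by (auto simp: distinct_parts_def)
    then show ?thesis using eq by blast
  qed
next
  fix D assume "D \<in> (`) Suc ` distinct_parts (Suc M) h \<union> (\<lambda>D. insert 1 (Suc ` D)) ` distinct_parts M h"
  then show "D \<in> distinct_parts (Suc M) (h + Suc M)"
    by (auto simp: distinct_parts_def card_image sum.reindex sum_Suc card_insert_if image_iff)
qed

text \<open>Conjugation in recursive form: both families obey the same recurrence, and each
  application lowers the weight by the positive amount \<open>Suc m\<close>.\<close>

lemma gapfree_eqpoll_distinct_parts: "gapfree M h \<approx> distinct_parts M h"
proof (induction h arbitrary: M rule: less_induct)
  case (less h)
  show ?case
  proof (cases M)
    case 0
    have "gapfree 0 h = (if h = 0 then {{#}} else {})"
      by (auto simp: gapfree_def)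
    moreover have "distinct_parts 0 h = (if h = 0 then {{}} else {})"
      by (auto simp: distinct_parts_def)
    ultimately show ?thesis using 0 by (auto simp: singleton_eqpoll)
  next
    case (Suc m)
    show ?thesis
    proof (cases "M \<le> h")
      \<comment> \<open>The recurrence needs weight at least \<open>M\<close>. Below that both sides
        are empty: a gap-free multiset contains \<open>M\<close> itself, and \<open>M\<close>
        distinct positive parts sum to at least \<open>M\<close>.\<close>
      case False
      have "sum_mset E \<ge> M" if "set_mset E = {1..M}" for E :: "nat multiset"
      proof -
        have "M \<in># E" using that Suc by simp
        then show ?thesis by (simp add: sum_mset.remove)
      qed
      then have 1: "gapfree M h = {}" using False by (fastforce simp: gapfree_def)
      have "\<Sum>D \<ge> card D" if "0 \<notin> D" for D :: "nat set"
        using that sum_bounded_below[of D 1 "\<lambda>x. x"] by (auto simp: Suc_le_eq intro: gr0I)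
      then have 2: "distinct_parts M h = {}" using False by (fastforce simp: distinct_parts_def)
      show ?thesis using 1 2 by simp
    next
      case True
      then obtain h' where h: "h = h' + Suc m" using Suc by (metis le_iff_add add.commute)
      have dis: "gapfree (Suc m) h' \<inter> gapfree m h' = {}"
        by (auto simp: gapfree_def)
      have "gapfree M h \<approx> gapfree (Suc m) h' \<union> gapfree m h'"
        unfolding Suc h gapfree_rec by (intro inj_on_image_eqpoll_self inj_onI) auto
      also have "\<dots> \<approx> (`) Suc ` distinct_parts (Suc m) h' \<union> (\<lambda>D. insert 1 (Suc ` D)) ` distinct_parts m h'"
      proof (rule Un_eqpoll_cong)
        have "gapfree (Suc m) h' \<approx> distinct_parts (Suc m) h'" using less h by simp
        also have "\<dots> \<approx> (`) Suc ` distinct_parts (Suc m) h'"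
          by (rule eqpoll_sym, rule inj_on_image_eqpoll_self) (simp add: inj_on_def inj_image_eq_iff)
        finally show "gapfree (Suc m) h' \<approx> (`) Suc ` distinct_parts (Suc m) h'" .
        have "gapfree m h' \<approx> distinct_parts m h'" using less h by simp
        also have "\<dots> \<approx> (\<lambda>D. insert 1 (Suc ` D)) ` distinct_parts m h'"
        proof (rule eqpoll_sym, rule inj_on_image_eqpoll_self, rule inj_onI)
          fix C D assume "C \<in> distinct_parts m h'" "D \<in> distinct_parts m h'"
            and "insert 1 (Suc ` C) = insert 1 (Suc ` D)"
          moreover from calculation have "1 \<notin> Suc ` C" "1 \<notin> Suc ` D" by (auto simp: distinct_parts_def)
          ultimately have "Suc ` C = Suc ` D" by (metis insert_ident)
          then show "C = D" by (simp add: inj_image_eq_iff)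
        qed
        finally show "gapfree m h' \<approx> (\<lambda>D. insert 1 (Suc ` D)) ` distinct_parts m h'" .
        show "disjnt (gapfree (Suc m) h') (gapfree m h')" using dis by (simp add: disjnt_def)
        show "disjnt ((`) Suc ` distinct_parts (Suc m) h') ((\<lambda>D. insert 1 (Suc ` D)) ` distinct_parts m h')"
          by (auto simp: disjnt_iff distinct_parts_def)
      qed
      also have "\<dots> = distinct_parts M h" unfolding Suc h distinct_parts_rec ..
      finally show ?thesis .
    qed
  qed
qed

section \<open>Profiles and splits, and the recurrence for splits\<close>

text \<open>
  An odd part \<open>2 j + 1\<close> is recorded as \<open>j\<close>, an even part \<open>2 i\<close> as \<open>i\<close>; thus the weight is
  \<open>2 h + k\<close>. In \<open>profiles\<close>, \<open>2 M\<close> is the largest even part (\<open>M = 0\<close> if there is none), and \<open>S\<close>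
  is the set of marked odd sizes.
\<close>

definition profiles :: "nat \<Rightarrow> nat \<Rightarrow> (nat \<times> nat multiset \<times> nat multiset \<times> nat set) set" where
  "profiles h k = {(M, E, A, S). set_mset E = {1..M} \<and> set_mset A \<subseteq> {..M} \<and> S \<subseteq> set_mset A \<inter> {..<M}
     \<and> sum_mset E + sum_mset A = h \<and> size A = k}"

text \<open>\<open>E_set\<close> in halved form: \<open>D\<close> holds the halves of the even
  parts, a set because these are distinct, and \<open>A\<close> records the odd parts as in
  \<open>profiles\<close>.\<close>

definition splits :: "nat \<Rightarrow> nat \<Rightarrow> (nat set \<times> nat multiset) set" where
  "splits h k = {(D, A). finite D \<and> 0 \<notin> D \<and> \<Sum>D + sum_mset A = h \<and> size A = k}"

lemma sum_mset_image_Suc: "sum_mset (image_mset Suc A) = sum_mset A + size A"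
  by (induction A) auto

lemma image_Suc_pred_mset: "0 \<notin># A \<Longrightarrow> image_mset Suc (image_mset (\<lambda>x. x - 1) A) = A"
  by (induction A) auto

lemma image_pred_Suc_mset: "image_mset (\<lambda>x. x - 1) (image_mset Suc A) = A"
  by (simp add: multiset.map_comp comp_def)

lemma image_Suc_mset_eq_iff: "image_mset Suc A = image_mset Suc B \<longleftrightarrow> A = B"
  by (metis image_pred_Suc_mset)

lemma image_Suc_mset_neq: "image_mset Suc A \<noteq> add_mset 0 B"
proof
  assume "image_mset Suc A = add_mset 0 B"
  then have "0 \<in># image_mset Suc A" by simp
  then show False by simp
qed

text \<open>This is \<open>splits\<close> at \<open>h - k\<close>, with the subtraction moved across
  the equation so that it cannot truncate; for \<open>k > h\<close> the set is empty.\<close>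

definition shifted_splits :: "nat \<Rightarrow> nat \<Rightarrow> (nat set \<times> nat multiset) set" where
  "shifted_splits h k = {(D, A). finite D \<and> 0 \<notin> D \<and> \<Sum>D + sum_mset A + k = h \<and> size A = k}"

lemma shifted_splits_eq: "shifted_splits h k = (if k \<le> h then splits (h - k) k else {})"
  by (auto simp: shifted_splits_def splits_def)

text \<open>A part 1, recorded as 0, can be removed without changing \<open>h\<close>. If there is
  none, 2 is subtracted from each of the \<open>Suc k\<close> odd parts, which lowers
  \<open>h\<close> by \<open>Suc k\<close>.\<close>

lemma splits_rec: "splits h (Suc k) \<approx> splits h k <+> shifted_splits h (Suc k)"
proof -
  define f where "f = case_sum (\<lambda>(D::nat set, A). (D, add_mset (0::nat) A)) (\<lambda>(D, A). (D, image_mset Suc A))"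
  have inj: "inj_on f (splits h k <+> shifted_splits h (Suc k))"
  proof (rule inj_onI)
    fix x y assume "f x = f y"
    then show "x = y"
      by (cases x; cases y)
        (auto simp: f_def dest: arg_cong[where f = set_mset] simp: image_Suc_mset_eq_iff image_Suc_mset_neq image_Suc_mset_neq[symmetric])
  qed
  have "f ` (splits h k <+> shifted_splits h (Suc k)) = splits h (Suc k)"
  proof (intro equalityI subsetI)
    fix x assume x: "x \<in> splits h (Suc k)"
    obtain D A where DA: "x = (D, A)" by (cases x)
    show "x \<in> f ` (splits h k <+> shifted_splits h (Suc k))"
    proof (cases "0 \<in># A")
      case True
      then obtain B where "A = add_mset 0 B" by (metis insert_DiffM)
      then have "x = f (Inl (D, B))" "(D, B) \<in> splits h k" using x DA by (auto simp: f_def splits_def)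
      then show ?thesis by blast
    next
      case False
      then have "x = f (Inr (D, image_mset (\<lambda>x. x - 1) A))" "(D, image_mset (\<lambda>x. x - 1) A) \<in> shifted_splits h (Suc k)"
        using x DA image_Suc_pred_mset[of A] sum_mset_image_Suc[of "image_mset (\<lambda>x. x - 1) A"] by (auto simp: f_def splits_def shifted_splits_def)
      then show ?thesis by blast
    qed
  qed (auto simp: f_def splits_def shifted_splits_def sum_mset_image_Suc)
  then show ?thesis
    using inj_on_image_eqpoll_self[OF inj] eqpoll_sym by metis
qed

section \<open>The exchange map, the recurrence for profiles, and the comparison with splits\<close>

definition shifted_profiles :: "nat \<Rightarrow> nat \<Rightarrow> (nat \<times> nat multiset \<times> nat multiset \<times> nat set) set" where
  "shifted_profiles h k = {(M, E, A, S). set_mset E = {1..M} \<and> set_mset A \<subseteq> {..M} \<and> S \<subseteq> set_mset A \<inter> {..<M}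
     \<and> sum_mset E + sum_mset A + k = h \<and> size A = k}"

lemma shifted_profiles_eq: "shifted_profiles h k = (if k \<le> h then profiles (h - k) k else {})"
  by (auto simp: shifted_profiles_def profiles_def)

text \<open>
  All odd parts are raised by \<open>2\<close>. This breaks the bounds of a profile only if it creates a part
  \<open>2 M + 3\<close> or a marked part \<open>2 M + 1\<close>; such a part is split into a marked \<open>1\<close> and an even part.
\<close>

fun exchange :: "nat \<times> nat multiset \<times> nat multiset \<times> nat set \<Rightarrow> nat \<times> nat multiset \<times> nat multiset \<times> nat set" where
  "exchange (M, E, A, S) =
     (if M \<in># A then
        (Suc M, add_mset (Suc M) E, add_mset 0 (image_mset Suc (A - {#M#})), insert 0 (Suc ` S))
      else if M - 1 \<in> S then
        (M, add_mset M E, add_mset 0 (image_mset Suc (A - {#M - 1#})), insert 0 (Suc ` (S - {M - 1})))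
      else (M, E, image_mset Suc A, Suc ` S))"

text \<open>For positive \<open>k\<close> this is the image of \<open>exchange\<close>. Every other
  profile contains a part 1 that is unmarked or repeated.\<close>

definition exceptional_profiles :: "nat \<Rightarrow> nat \<Rightarrow> (nat \<times> nat multiset \<times> nat multiset \<times> nat set) set" where
  "exceptional_profiles h k = {(M, E, A, S) \<in> profiles h k. 0 \<in># A \<longrightarrow> count A 0 = 1 \<and> 0 \<in> S}"

lemma add_mset_0_cases:
  assumes "count A 0 = 1"
  obtains B where "A = add_mset 0 (image_mset Suc B)"
proof -
  have "0 \<in># A" using assms by (simp flip: count_greater_zero_iff)
  then obtain C where C: "A = add_mset 0 C" by (metis insert_DiffM)
  then have "0 \<notin># C" using assms by (simp add: not_in_iff)
  then show thesis using that C image_Suc_pred_mset by metis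
qed

text \<open>Raising all odd parts accounts for the \<open>Suc k\<close> in the weight condition. An
  entry \<open>r\<close> taken out of \<open>A\<close> returns as \<open>r + 1\<close> in
  \<open>E\<close> together with a marked 0, so the total stays \<open>h\<close>; this 0 is the only
  one, since all other entries are successors.\<close>

lemma exchange_in_exceptional_profiles:
  assumes "x \<in> shifted_profiles h (Suc k)"
  shows "exchange x \<in> exceptional_profiles h (Suc k)"
proof -
  obtain M E A S where x: "x = (M, E, A, S)" by (cases x)
  have W: "set_mset E = {1..M}" "set_mset A \<subseteq> {..M}" "S \<subseteq> set_mset A" "S \<subseteq> {..<M}"
    "sum_mset E + sum_mset A + Suc k = h" "size A = Suc k"
    using assms x by (auto simp: shifted_profiles_def)
  have c0: "count (image_mset Suc B) 0 = 0" for B by (simp add: count_eq_zero_iff)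
  consider "M \<in># A" | "M \<notin># A" "M - 1 \<in> S" | "M \<notin># A" "M - 1 \<notin> S" by blast
  then show ?thesis
  proof cases
    case 1
    then obtain B where B: "A = add_mset M B" by (metis insert_DiffM)
    \<comment> \<open>Marks lie strictly below \<open>M\<close>, so taking out a copy of
      \<open>M\<close> leaves every marked size present.\<close>
    have "S \<subseteq> set_mset B" using W B by auto
    then show ?thesis using W B x c0
      by (auto simp: exceptional_profiles_def profiles_def sum_mset_image_Suc)
  next
    case 2
    \<comment> \<open>For \<open>M = 0\<close> the truncated \<open>M - 1\<close> is 0, but then
      \<open>S\<close> is empty, so this case forces \<open>M > 0\<close>.\<close>
    have M: "M > 0" using 2 W by (auto intro: gr0I)
    obtain B where B: "A = add_mset (M - 1) B" using 2 W by (metis insert_DiffM subsetD)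
    have sub: "S - {M - 1} \<subseteq> set_mset B" using W B by auto
    have lt: "Suc s < M" if "s \<in> S" "s \<noteq> M - 1" for s using that W by fastforce
    have le: "s < M" if "s \<in># B" for s using that W B 2 by (metis insert_iff set_mset_add_mset_insert subsetD atMost_iff le_neq_implies_less)
    show ?thesis using W B x c0 2 M sub lt
      by (auto dest!: le simp: Suc_le_eq exceptional_profiles_def profiles_def sum_mset_image_Suc)
  next
    case 3
    have lt: "Suc s < M" if "s \<in> S" for s
    proof -
      have "s < M" "s \<noteq> M - 1" using that W 3 by auto
      then show ?thesis by simp
    qed
    have le: "s < M" if "s \<in># A" for s using that W 3 by (metis subsetD atMost_iff le_neq_implies_less)
    show ?thesis using W x c0 3 lt
      by (auto dest!: le simp: Suc_le_eq exceptional_profiles_def profiles_def sum_mset_image_Suc)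
  qed
qed

text \<open>The inverse map. If 0 is absent from \<open>A\<close>, all entries are lowered by 1.
  Otherwise the marked 0 and one copy of \<open>M\<close> from \<open>E\<close> are merged into an
  odd entry \<open>m = M - 1\<close>; whether \<open>M\<close> survives in \<open>E\<close> tells
  which branch of \<open>exchange\<close> is undone.\<close>

lemma exceptional_profile_in_exchange_image:
  assumes "x \<in> exceptional_profiles h (Suc k)"
  shows "x \<in> exchange ` shifted_profiles h (Suc k)"
proof -
  obtain M E A S where x: "x = (M, E, A, S)" by (cases x)
  have W: "set_mset E = {1..M}" "set_mset A \<subseteq> {..M}" "S \<subseteq> set_mset A" "S \<subseteq> {..<M}"
    "sum_mset E + sum_mset A = h" "size A = Suc k" "0 \<in># A \<longrightarrow> count A 0 = 1 \<and> 0 \<in> S"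
    using assms x by (auto simp: exceptional_profiles_def profiles_def)
  define T where "T = Suc -` S"
  show ?thesis
  proof (cases "0 \<in># A")
    case False
    then obtain B where B: "A = image_mset Suc B" using image_Suc_pred_mset by metis
    have "0 \<notin> S" using False W by auto
    then have S: "S = Suc ` T" using Suc_vimage by (simp add: T_def)
    \<comment> \<open>Neither special branch of \<open>exchange\<close> applies to the lowered
      profile: either would put an entry or a mark of \<open>x\<close> beyond its bound.\<close>
    have 1: "M \<notin># B" using W B by auto
    have 2: "M - 1 \<notin> T" 
    proof
      assume "M - 1 \<in> T"
      then have "Suc (M - 1) \<in> S" by (simp add: T_def)
      then show False using W by auto
    qed
    have "(M, E, B, T) \<in> shifted_profiles h (Suc k)" using W B S 1
      by (auto simp: shifted_profiles_def sum_mset_image_Suc)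
    moreover have "x = exchange (M, E, B, T)" using x B S 1 2 by simp
    ultimately show ?thesis by blast
  next
    case True
    then obtain B where B: "A = add_mset 0 (image_mset Suc B)" using W add_mset_0_cases by metis
    have 0: "0 \<in> S" using True W by auto
    then have S: "S = insert 0 (Suc ` T)" using Suc_vimage[of S] by (auto simp: T_def)
    have M: "M > 0" using 0 W by auto
    then obtain m where m: "M = Suc m" by (cases M) auto
    obtain F where F: "E = add_mset M F" using M W by (metis insert_DiffM atLeastAtMost_iff Suc_leI One_nat_def order_refl)
    have TB: "T \<subseteq> set_mset B" using W B S by auto
    have Tm: "T \<subseteq> {..<m}" using W S m by auto
    have Bm: "set_mset B \<subseteq> {..m}" using W B m by auto
    show ?thesis
    proof (cases "M \<in># F")
      \<comment> \<open>\<open>M\<close> still occurs, so the bound is kept and \<open>m\<close>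
        returns with its mark.\<close>
      case True
      have F': "set_mset F = {1..M}" using True W F by auto
      have "(M, F, add_mset m B, insert m T) \<in> shifted_profiles h (Suc k)"
        using W B S F F' TB Tm Bm m by (auto simp: shifted_profiles_def sum_mset_image_Suc)
      moreover have "x = exchange (M, F, add_mset m B, insert m T)"
        using x B S F m Bm Tm by auto
      ultimately show ?thesis by blast
    next
      \<comment> \<open>The last copy of \<open>M\<close> is gone, so the bound drops to
        \<open>m\<close>; the returning entry equals the new bound and carries no mark.\<close>
      case False
      have "insert M (set_mset F) = insert M {1..m}" using W F m by (simp add: atLeastAtMostSuc_conv)
      then have F': "set_mset F = {1..m}" using False insert_ident[of M "set_mset F" "{1..m}"] m by simp
      have "(m, F, add_mset m B, T) \<in> shifted_profiles h (Suc k)"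
        using W B S F F' TB Tm Bm m by (auto simp: shifted_profiles_def sum_mset_image_Suc)
      moreover have "x = exchange (m, F, add_mset m B, T)"
        using x B S F m by auto
      ultimately show ?thesis by blast
    qed
  qed
qed

text \<open>An entry 0 in the third component reveals a special branch. If the two special branches
  gave the same result, the even parts before would coincide, yet the first branch adds a value
  absent from them and the second a value already present.\<close>

lemma inj_on_exchange: "inj_on exchange (shifted_profiles h k)"
proof (rule inj_onI)
  fix x y assume xy: "x \<in> shifted_profiles h k" "y \<in> shifted_profiles h k" "exchange x = exchange y"
  obtain M E A S where x: "x = (M, E, A, S)" by (cases x)
  obtain N F B T where y: "y = (N, F, B, T)" by (cases y)
  have W: "set_mset E = {1..M}" "S \<subseteq> set_mset A" "S \<subseteq> {..<M}"
    "set_mset F = {1..N}" "T \<subseteq> set_mset B" "T \<subseteq> {..<N}"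
    using xy x y by (auto simp: shifted_profiles_def)
  have cancel: "A = B" if "r \<in># A" "r \<in># B" "A - {#r#} = B - {#r#}" for r
    using that by (metis insert_DiffM)
  have fresh: "Suc M \<notin># E" "Suc N \<notin># F" using W by auto
  have old: "M - 1 \<in> S \<Longrightarrow> M \<in># E \<and> M - 1 \<in># A" "N - 1 \<in> T \<Longrightarrow> N \<in># F \<and> N - 1 \<in># B"
    using W by (cases M; cases N; auto)+
  have zero: "M \<in># A \<or> M - 1 \<in> S \<longleftrightarrow> N \<in># B \<or> N - 1 \<in> T"
  proof -
    have "0 \<in># fst (snd (snd (exchange x))) \<longleftrightarrow> M \<in># A \<or> M - 1 \<in> S" by (simp add: x)
    moreover have "0 \<in># fst (snd (snd (exchange y))) \<longleftrightarrow> N \<in># B \<or> N - 1 \<in> T" by (simp add: y)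
    ultimately show ?thesis using xy(3) by simp
  qed
  have insD: "P = Q" if "insert 0 (Suc ` P) = insert 0 (Suc ` Q)" for P Q
    using that by auto
  have eq: "exchange (M, E, A, S) = exchange (N, F, B, T)" using xy(3) x y by simp
  note simps = image_Suc_mset_eq_iff inj_image_eq_iff[OF inj_Suc]
  consider "M \<in># A" "N \<in># B" | "M \<in># A" "N \<notin># B" "N - 1 \<in> T"
    | "M \<notin># A" "N \<in># B" "M - 1 \<in> S" | "M \<notin># A" "N \<notin># B" "M - 1 \<in> S" "N - 1 \<in> T"
    | "M \<notin># A" "N \<notin># B" "M - 1 \<notin> S" "N - 1 \<notin> T"
    using zero by blast
  then show "x = y"
  proof cases
    case 1
    have "M = N" using eq 1 by simp
    moreover from this have "E = F" "A - {#M#} = B - {#M#}" "S = T"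
      using eq 1 by (auto simp: simps dest: insD)
    ultimately show ?thesis using 1 cancel x y by blast
  next
    case 2
    have "N = Suc M" using eq 2 by simp
    moreover from this have "E = F" using eq 2 by simp
    ultimately show ?thesis using 2 fresh old by blast
  next
    case 3
    have "M = Suc N" using eq 3 by simp
    moreover from this have "E = F" using eq 3 by simp
    ultimately show ?thesis using 3 fresh old by blast
  next
    case 4
    have "M = N" using eq 4 by simp
    moreover from this have "E = F" "A - {#M - 1#} = B - {#M - 1#}" "S - {M - 1} = T - {M - 1}"
      using eq 4 by (auto simp: simps dest: insD)
    ultimately show ?thesis using 4 old cancel x y by blast
  next
    case 5
    then show ?thesis using eq x y by (simp add: simps)
  qed
qed

lemma exceptional_profiles_eqpoll: "exceptional_profiles h (Suc k) \<approx> shifted_profiles h (Suc k)"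
proof -
  have "exceptional_profiles h (Suc k) = exchange ` shifted_profiles h (Suc k)"
    using exchange_in_exceptional_profiles exceptional_profile_in_exchange_image by blast
  then show ?thesis using inj_on_image_eqpoll_self[OF inj_on_exchange] by simp
qed

text \<open>If a part 1 is unmarked or repeated, deleting one copy leaves the marks valid and
  \<open>h\<close> unchanged.\<close>

lemma profiles_minus_exceptional_profiles:
  "profiles h (Suc k) - exceptional_profiles h (Suc k) = (\<lambda>(M, E, A, S). (M, E, add_mset 0 A, S)) ` profiles h k"
  (is "_ = ?f ` _")
proof (intro equalityI subsetI)
  fix x assume x: "x \<in> profiles h (Suc k) - exceptional_profiles h (Suc k)"
  obtain M E A S where xx: "x = (M, E, A, S)" by (cases x)
  have "0 \<in># A" using x xx by (auto simp: exceptional_profiles_def)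
  then obtain B where B: "A = add_mset 0 B" by (metis insert_DiffM)
  have "0 \<notin> S \<or> 0 \<in># B" using x xx B by (auto simp: exceptional_profiles_def simp flip: not_in_iff)
  then have "(M, E, B, S) \<in> profiles h k" using x xx B by (auto simp: profiles_def)
  then show "x \<in> ?f ` profiles h k" using xx B by force
next
  fix x assume "x \<in> ?f ` profiles h k"
  then show "x \<in> profiles h (Suc k) - exceptional_profiles h (Suc k)"
    by (auto simp: exceptional_profiles_def profiles_def simp flip: not_in_iff)
qed

lemma Un_eqpoll_Plus:
  assumes "A \<inter> B = {}"
  shows "A \<union> B \<approx> A <+> B"
proof -
  have "A \<union> B = case_sum id id ` (A <+> B)" by (force simp: image_iff)
  moreover have "inj_on (case_sum id id) (A <+> B)" using assms by (auto simp: inj_on_def)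
  ultimately show ?thesis by (metis inj_on_image_eqpoll_self eqpoll_sym)
qed

lemma profiles_rec: "profiles h (Suc k) \<approx> profiles h k <+> shifted_profiles h (Suc k)"
proof -
  have "profiles h (Suc k) = (profiles h (Suc k) - exceptional_profiles h (Suc k)) \<union> exceptional_profiles h (Suc k)"
    by (auto simp: exceptional_profiles_def)
  also have "\<dots> \<approx> (profiles h (Suc k) - exceptional_profiles h (Suc k)) <+> exceptional_profiles h (Suc k)"
    by (rule Un_eqpoll_Plus) blast
  also have "\<dots> \<approx> profiles h k <+> shifted_profiles h (Suc k)"
  proof (rule sum_eqpoll_cong)
    show "profiles h (Suc k) - exceptional_profiles h (Suc k) \<approx> profiles h k"
      unfolding profiles_minus_exceptional_profiles by (rule inj_on_image_eqpoll_self) (auto simp: inj_on_def)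
  qed (rule exceptional_profiles_eqpoll)
  finally show ?thesis .
qed

text \<open>Without odd parts \<open>A\<close> and \<open>S\<close> are empty, so conjugation
  applies for each \<open>M\<close> separately.\<close>

lemma profiles_0_eqpoll: "profiles h 0 \<approx> splits h 0"
proof -
  have "profiles h 0 = (\<lambda>(M, E). (M, E, {#}, {})) ` (SIGMA M:UNIV. gapfree M h)"
    by (auto simp: profiles_def gapfree_def image_iff)
  also have "\<dots> \<approx> (SIGMA M:UNIV. gapfree M h)"
    by (rule inj_on_image_eqpoll_self) (auto simp: inj_on_def)
  also have "\<dots> \<approx> (SIGMA M:UNIV. distinct_parts M h)"
    by (rule Sigma_eqpoll_cong[where h = id]) (auto simp: gapfree_eqpoll_distinct_parts)
  \<comment> \<open>The index \<open>M\<close> is recovered as \<open>card D\<close>.\<close>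
  also have "\<dots> \<approx> (\<lambda>(M, D). (D, {#})) ` (SIGMA M:UNIV. distinct_parts M h)"
    by (rule eqpoll_sym, rule inj_on_image_eqpoll_self) (auto simp: inj_on_def distinct_parts_def)
  also have "\<dots> = splits h 0"
    by (auto simp: splits_def distinct_parts_def image_iff)
  finally show ?thesis .
qed

text \<open>In the common recurrence the first summand has smaller \<open>k\<close>, and the second
  lives at \<open>h - Suc k\<close> or is empty on both sides; hence the nested induction.\<close>

lemma profiles_eqpoll_splits: "profiles h k \<approx> splits h k"
proof (induction k arbitrary: h)
  case 0
  show ?case by (rule profiles_0_eqpoll)
next
  case (Suc k)
  note IHk = Suc
  show ?case
  proof (induction h rule: less_induct)
    case (less h)
    have "shifted_profiles h (Suc k) \<approx> shifted_splits h (Suc k)"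
      using less by (auto simp: shifted_profiles_eq shifted_splits_eq)
    then have "profiles h k <+> shifted_profiles h (Suc k) \<approx> splits h k <+> shifted_splits h (Suc k)"
      by (intro sum_eqpoll_cong IHk)
    then show ?case by (rule eqpoll_trans[OF profiles_rec eqpoll_trans[OF _ eqpoll_sym[OF splits_rec]]])
  qed
qed

section \<open>Grounded partitions as multisets of sizes with marks\<close>

definition step :: "nat \<times> colour \<Rightarrow> nat \<times> colour \<Rightarrow> bool" where
  "step p q \<longleftrightarrow> int (fst q) - int (fst p) = \<bar>2 - colour_index (snd p) - colour_index (snd q)\<bar>"

primrec chain :: "('a \<Rightarrow> 'a \<Rightarrow> bool) \<Rightarrow> 'a \<Rightarrow> 'a list \<Rightarrow> bool" where
  "chain r x [] \<longleftrightarrow> True"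
| "chain r x (y # ys) \<longleftrightarrow> r x y \<and> chain r y ys"

lemma chain_iff_nth: "chain r x xs \<longleftrightarrow> (\<forall>j<length xs. r ((x # xs) ! j) ((x # xs) ! Suc j))"
  by (induction xs arbitrary: x) (simp_all add: All_less_Suc2)

lemma grounded_partition_iff_chain:
  "grounded_partition ps \<longleftrightarrow> (\<forall>x\<in>set ps. 0 < fst x) \<and> chain step (0, Col_a) ps"
  unfolding grounded_partition_def chain_iff_nth step_def Let_def ..

definition parity_ok :: "nat \<times> colour \<Rightarrow> bool" where
  "parity_ok p \<longleftrightarrow> (odd (fst p) \<longleftrightarrow> snd p = Col_b)"

text \<open>What remains of \<open>step\<close> when colours are forgotten, given that the odd sizes
  are exactly those coloured \<open>Col_b\<close>.\<close>

definition size_step :: "nat \<Rightarrow> nat \<Rightarrow> bool" where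
  "size_step x y \<longleftrightarrow> y = x \<or> y = Suc x \<or> even x \<and> y = Suc (Suc x)"

text \<open>Between even parts the colour is forced: a repeated size swaps \<open>Col_a\<close> and
  \<open>Col_c\<close>, a jump by 2 keeps the colour. Only an even part after an odd one leaves a
  choice, which \<open>S\<close> makes.\<close>

definition next_colour :: "nat set \<Rightarrow> nat \<times> colour \<Rightarrow> nat \<Rightarrow> colour" where
  "next_colour S p y =
     (if odd y then Col_b
      else if odd (fst p) then if fst p div 2 \<in> S then Col_c else Col_a
      else if y = fst p then if snd p = Col_a then Col_c else Col_a
      else snd p)"

primrec colouring :: "nat set \<Rightarrow> nat \<times> colour \<Rightarrow> nat list \<Rightarrow> (nat \<times> colour) list" where
  "colouring S p [] = []"
| "colouring S p (y # ys) = (y, next_colour S p y) # colouring S (y, next_colour S p y) ys"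

text \<open>Reads off the choices made by \<open>next_colour\<close>; \<open>fst p div 2\<close> is
  the \<open>j\<close> of an odd size \<open>2 * j + 1\<close>.\<close>

primrec exits_to_c :: "nat \<times> colour \<Rightarrow> (nat \<times> colour) list \<Rightarrow> nat set" where
  "exits_to_c p [] = {}"
| "exits_to_c p (q # ps) =
     (if snd p = Col_b \<and> snd q = Col_c then {fst p div 2} else {}) \<union> exits_to_c q ps"

text \<open>The required difference is odd exactly when one of the two colours is
  \<open>Col_b\<close> and the other is not.\<close>

lemma step_parity_ok: "step p q \<Longrightarrow> parity_ok p \<Longrightarrow> parity_ok q"
  by (cases "snd p"; cases "snd q") (auto simp: step_def parity_ok_def; presburger)+

lemma step_size_step: "step p q \<Longrightarrow> parity_ok p \<Longrightarrow> size_step (fst p) (fst q)"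
  by (cases "snd p"; cases "snd q") (auto simp: step_def parity_ok_def size_step_def)

lemma step_next_colour:
  assumes "parity_ok p" "size_step (fst p) y"
  shows "step p (y, next_colour S p y)"
  using assms
  by (cases "snd p") (auto simp: step_def parity_ok_def size_step_def next_colour_def)

lemma next_colour_eq:
  assumes "step p q" "parity_ok p" "snd p = Col_b \<Longrightarrow> even (fst q) \<Longrightarrow> fst p div 2 \<in> S \<longleftrightarrow> snd q = Col_c"
  shows "next_colour S p (fst q) = snd q"
proof -
  have "parity_ok q" using assms step_parity_ok by blast
  then show ?thesis
    using assms by (cases "snd p"; cases "snd q") (auto simp: step_def parity_ok_def next_colour_def)
qed

text \<open>An odd size \<open>2 * j + 1\<close> can be left only for \<open>2 * j + 2\<close>. The
  bound on \<open>fst p\<close> serves to show that \<open>j\<close> is not recorded again once this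
  size has been passed.\<close>

lemma exits_to_c_subset:
  "chain step p ps \<Longrightarrow> parity_ok p \<Longrightarrow> j \<in> exits_to_c p ps \<Longrightarrow>
     2 * j + 1 \<in> fst ` set (p # ps) \<and> 2 * j + 2 \<in> fst ` set ps \<and> fst p \<le> 2 * j + 1"
proof (induction ps arbitrary: p)
  case (Cons q ps)
  have q: "parity_ok q" "size_step (fst p) (fst q)"
    using Cons.prems step_parity_ok[of p q] step_size_step[of p q] by auto
  show ?case
  proof (cases "j \<in> exits_to_c q ps")
    case True
    then show ?thesis using Cons.IH[of q] Cons.prems q by (auto simp: size_step_def)
  next
    case False
    then have j: "snd p = Col_b" "snd q = Col_c" "j = fst p div 2"
      using Cons.prems by (auto split: if_splits)
    have "odd (fst p)" using j Cons.prems by (simp add: parity_ok_def)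
    then have "2 * j + 1 = fst p" using j by simp
    moreover have "fst q = Suc (fst p)" using j Cons.prems by (simp add: step_def)
    ultimately show ?thesis by simp
  qed
qed simp

text \<open>\<open>S\<close> stays fixed while \<open>exits_to_c\<close> shrinks along the list, so
  agreement is asked only for those \<open>j\<close> that can still be recorded.\<close>

lemma colouring_map_fst:
  "chain step p ps \<Longrightarrow> parity_ok p \<Longrightarrow> (\<And>j. fst p \<le> 2 * j + 1 \<Longrightarrow> j \<in> S \<longleftrightarrow> j \<in> exits_to_c p ps) \<Longrightarrow>
     colouring S p (map fst ps) = ps"
proof (induction ps arbitrary: p)
  case (Cons q ps)
  have q: "parity_ok q" "step p q" "size_step (fst p) (fst q)" "chain step q ps"
    using Cons.prems step_parity_ok[of p q] step_size_step[of p q] by auto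
  have "fst p div 2 \<in> S \<longleftrightarrow> snd q = Col_c" if p: "snd p = Col_b" and ev: "even (fst q)"
  proof -
    have op: "2 * (fst p div 2) + 1 = fst p" "odd (fst p)" using p Cons.prems by (simp_all add: parity_ok_def)
    \<comment> \<open>The run of size \<open>fst p\<close> ends here, so its mark is recorded at
      this step or never.\<close>
    have "fst p \<noteq> fst q" using op ev by auto
    then have "fst p div 2 \<notin> exits_to_c q ps"
      using exits_to_c_subset[of q ps "fst p div 2"] q op by (auto simp: size_step_def)
    then show ?thesis using Cons.prems(3)[of "fst p div 2"] op p by auto
  qed
  then have c: "next_colour S p (fst q) = snd q"
    using q Cons.prems by (intro next_colour_eq) auto
  have "j \<in> S \<longleftrightarrow> j \<in> exits_to_c q ps" if "fst q \<le> 2 * j + 1" for j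
  proof -
    have "fst p \<le> 2 * j + 1" using that q by (auto simp: size_step_def)
    moreover have "j \<noteq> fst p div 2" if "snd p = Col_b" "snd q = Col_c"
    proof -
      have "fst q = Suc (fst p)" using that q by (simp add: step_def)
      moreover have "odd (fst p)" using that Cons.prems by (simp add: parity_ok_def)
      ultimately show ?thesis using \<open>fst q \<le> 2 * j + 1\<close> by presburger
    qed
    ultimately show ?thesis using Cons.prems(3)[of j] by auto
  qed
  then show ?case using c Cons.IH[of q] q by simp
qed simp

lemma map_fst_colouring [simp]: "map fst (colouring S p xs) = xs"
  by (induction xs arbitrary: p) auto

lemma chain_colouring:
  "chain size_step (fst p) xs \<Longrightarrow> parity_ok p \<Longrightarrow> chain step p (colouring S p xs)"
proof (induction xs arbitrary: p)
  case (Cons y ys)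
  then have "step p (y, next_colour S p y)" by (simp add: step_next_colour)
  then show ?case using Cons step_parity_ok by simp
qed simp

lemma chain_map_fst: "chain step p ps \<Longrightarrow> parity_ok p \<Longrightarrow> chain size_step (fst p) (map fst ps)"
  by (induction ps arbitrary: p) (auto intro: step_size_step dest: step_parity_ok)

text \<open>No even number is jumped over. In this form the local condition extends to a whole
  list.\<close>

lemma size_step_iff: "size_step x y \<longleftrightarrow> x \<le> y \<and> (\<forall>e. even e \<longrightarrow> x < e \<longrightarrow> y \<le> e)"
proof
  assume R: "x \<le> y \<and> (\<forall>e. even e \<longrightarrow> x < e \<longrightarrow> y \<le> e)"
  show "size_step x y"
  proof (cases "even x")
    case True
    then have "y \<le> Suc (Suc x)" using R by simp
    then have "y = x \<or> y = Suc x \<or> y = Suc (Suc x)" using R by linarith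
    then show ?thesis using True by (auto simp: size_step_def)
  next
    case False
    then have "y \<le> Suc x" using R by simp
    then have "y = x \<or> y = Suc x" using R by linarith
    then show ?thesis by (auto simp: size_step_def)
  qed
next
  assume "size_step x y"
  then consider "y \<le> Suc x" "x \<le> y" | "even x" "y = Suc (Suc x)" by (auto simp: size_step_def)
  then show "x \<le> y \<and> (\<forall>e. even e \<longrightarrow> x < e \<longrightarrow> y \<le> e)"
  proof cases
    case 2
    have "y \<le> e" if "even e" "x < e" for e
      using that 2 by presburger
    then show ?thesis using 2 by simp
  qed auto
qed

text \<open>For sorted lists, being a chain thus depends only on the set of entries, which allows
  the passage to multisets.\<close>

lemma chain_size_step_iff:
  "chain size_step x xs \<longleftrightarrow>
     sorted (x # xs) \<and> (\<forall>r\<in>set xs. \<forall>e. even e \<longrightarrow> x < e \<longrightarrow> e < r \<longrightarrow> e \<in> set xs)"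
proof (induction xs arbitrary: x)
  case (Cons y ys)
  have split: "(\<forall>r\<in>set (y # ys). \<forall>e. even e \<longrightarrow> x < e \<longrightarrow> e < r \<longrightarrow> e \<in> set (y # ys)) \<longleftrightarrow>
      (\<forall>e. even e \<longrightarrow> x < e \<longrightarrow> y \<le> e) \<and> (\<forall>r\<in>set ys. \<forall>e. even e \<longrightarrow> y < e \<longrightarrow> e < r \<longrightarrow> e \<in> set ys)"
    (is "?L \<longleftrightarrow> ?R")
    if le: "x \<le> y" "\<forall>z\<in>set ys. y \<le> z"
  proof
    assume L: ?L
    have "y \<le> e" if "even e" "x < e" for e
    proof (rule ccontr)
      assume "\<not> y \<le> e"
      then have "e \<in> set (y # ys)" using L that by (meson list.set_intros(1) not_le)
      then show False using le \<open>\<not> y \<le> e\<close> by auto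
    qed
    moreover have "e \<in> set ys" if "r \<in> set ys" "even e" "y < e" "e < r" for r e
    proof -
      have "e \<in> set (y # ys)" using L that le(1) by (meson le_less_trans list.set_intros(2))
      then show ?thesis using that by simp
    qed
    ultimately show ?R by blast
  next
    assume R: ?R
    have "e \<in> set (y # ys)" if "r \<in> set (y # ys)" "even e" "x < e" "e < r" for r e
    proof -
      have "y \<le> e" using R that by blast
      moreover have "r \<in> set ys" using calculation that by auto
      ultimately show ?thesis using R that by (cases "y = e") auto
    qed
    then show ?L by blast
  qed
  have srt: "sorted (x # y # ys) \<longleftrightarrow> x \<le> y \<and> sorted (y # ys)" by auto
  show ?case
  proof (cases "x \<le> y \<and> sorted (y # ys)")
    case True
    then have "\<forall>z\<in>set ys. y \<le> z" by simp
    then show ?thesis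
      using True by (simp only: chain.simps size_step_iff[of x y] Cons.IH[of y] split srt simp_thms)
  next
    case False
    then have "\<not> chain size_step x (y # ys)"
      by (simp only: chain.simps size_step_iff[of x y] Cons.IH[of y] simp_thms de_Morgan_conj) (elim disjE; simp only: simp_thms)
    then show ?thesis using False by (simp only: srt simp_thms)
  qed
qed simp

text \<open>A mark on \<open>2 * j + 1\<close> takes effect only where the run of this size is
  followed by an even part, which must be \<open>2 * j + 2\<close>.\<close>

lemma exits_to_c_colouring:
  "chain size_step (fst p) xs \<Longrightarrow> parity_ok p \<Longrightarrow>
     exits_to_c p (colouring S p xs) = {j \<in> S. 2 * j + 1 \<in> set (fst p # xs) \<and> 2 * j + 2 \<in> set xs}"
proof (induction xs arbitrary: p)
  case (Cons y ys)
  define c where "c = next_colour S p y"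
  have y: "size_step (fst p) y" "chain size_step y ys" using Cons.prems by auto
  have q: "parity_ok (y, c)" using Cons.prems y step_next_colour step_parity_ok c_def by metis
  have ge: "\<forall>z\<in>set ys. y \<le> z" using y by (simp add: chain_size_step_iff)
  have IH: "exits_to_c (y, c) (colouring S (y, c) ys) = {j \<in> S. 2 * j + 1 \<in> set (y # ys) \<and> 2 * j + 2 \<in> set ys}"
    using Cons.IH[of "(y, c)"] y q by simp
  have new: "(if snd p = Col_b \<and> c = Col_c then {fst p div 2} else {}) = {j \<in> S. 2 * j + 1 = fst p \<and> 2 * j + 2 = y}"
  proof (cases "odd (fst p) \<and> even y")
    case True
    then have "y = Suc (fst p)" using y by (auto simp: size_step_def)
    moreover from True obtain i where "fst p = 2 * i + 1" by (auto elim: oddE)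
    ultimately show ?thesis using Cons.prems by (auto simp: c_def next_colour_def parity_ok_def)
  next
    case False
    then have "\<not> (snd p = Col_b \<and> c = Col_c)" using Cons.prems(2) by (auto simp: c_def next_colour_def parity_ok_def)
    moreover have "\<not> (2 * j + 1 = fst p \<and> 2 * j + 2 = y)" for j
      using False by (metis even_Suc even_mult_iff even_numeral add_2_eq_Suc' Suc_eq_plus1)
    ultimately show ?thesis by auto
  qed
  \<comment> \<open>If \<open>2 * j + 2\<close> comes later but not next, the chain must stay at the
    odd size \<open>2 * j + 1\<close>.\<close>
  have a1: "2 * j + 1 \<in> set (y # ys) \<and> 2 * j + 2 \<in> set ys" 
    if "2 * j + 1 = fst p" "2 * j + 2 \<in> set ys" "2 * j + 2 \<noteq> y" for j
    using that y ge by (fastforce simp: size_step_def)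
  have a2: False if "2 * j + 1 \<in> set (y # ys)" "2 * j + 2 = y" for j
    using that ge by auto
  have iff: "(2 * j + 1 = fst p \<and> 2 * j + 2 = y) \<or> (2 * j + 1 \<in> set (y # ys) \<and> 2 * j + 2 \<in> set ys) \<longleftrightarrow>
      2 * j + 1 \<in> set (fst p # y # ys) \<and> 2 * j + 2 \<in> set (y # ys)" (is "?L \<longleftrightarrow> ?R") for j
  proof
    show "?L \<Longrightarrow> ?R" by (elim disjE conjE) simp_all
  next
    assume R: ?R
    show ?L
    proof (cases "2 * j + 2 = y")
      case True
      then have "2 * j + 1 = fst p" using R a2[of j] by (metis set_ConsD)
      then show ?thesis using True by simp
    next
      case False
      then have "2 * j + 2 \<in> set ys" using R by simp
      then show ?thesis using R a1[of j] False by (metis set_ConsD)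
    qed
  qed
  have "exits_to_c p (colouring S p (y # ys)) =
      (if snd p = Col_b \<and> c = Col_c then {fst p div 2} else {}) \<union> exits_to_c (y, c) (colouring S (y, c) ys)"
    by (simp only: colouring.simps exits_to_c.simps fst_conv snd_conv c_def)
  also have "\<dots> = {j \<in> S. (2 * j + 1 = fst p \<and> 2 * j + 2 = y) \<or> (2 * j + 1 \<in> set (y # ys) \<and> 2 * j + 2 \<in> set ys)}"
    unfolding new IH by blast
  finally show ?case unfolding iff .
qed simp

text \<open>
  The free choices in a grounded partition are the colours of the first even part after a run of
  odd parts; \<open>S\<close> collects the \<open>j\<close> for which the part following the run of \<open>2 j + 1\<close> has colour
  \<open>c\<close> rather than \<open>a\<close>.
\<close>

definition coloured_msets :: "nat \<Rightarrow> nat \<Rightarrow> (nat multiset \<times> nat set) set" where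
  "coloured_msets n k = {(R, S). 0 \<notin># R \<and> (\<forall>r\<in>#R. \<forall>e. even e \<longrightarrow> 0 < e \<longrightarrow> e < r \<longrightarrow> e \<in># R)
     \<and> S \<subseteq> {j. 2 * j + 1 \<in># R \<and> 2 * j + 2 \<in># R} \<and> sum_mset R = n \<and> size (filter_mset odd R) = k}"

lemma parity_ok_ground: "parity_ok (0, Col_a)"
  by (simp add: parity_ok_def)

lemma weight_eq: "weight ps = sum_mset (mset (map fst ps))"
  unfolding weight_def by (rule sum_mset_sum_list[symmetric])

lemma num_odd_parts_eq: "num_odd_parts ps = size (filter_mset odd (mset (map fst ps)))"
  by (induction ps) (auto simp: num_odd_parts_def)

text \<open>Sizes weakly increase along a grounded partition, so sorting the multiset restores their
  order, and the marks restore the colours.\<close>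

lemma P_a_eqpoll_coloured_msets: "P_a n k \<approx> coloured_msets n k"
proof -
  let ?g = "(0, Col_a)"
  define f where "f ps = (mset (map fst ps), exits_to_c ?g ps)" for ps
  define g where "g = (\<lambda>(R, S). colouring S ?g (sorted_list_of_multiset R))"
  have "bij_betw f (P_a n k) (coloured_msets n k)"
  proof (rule bij_betw_byWitness[where f' = g])
    show "\<forall>ps\<in>P_a n k. g (f ps) = ps"
    proof
      fix ps assume "ps \<in> P_a n k"
      then have ch: "chain step ?g ps" by (simp add: P_a_def grounded_partition_iff_chain)
      then have "sorted (map fst ps)"
        using chain_map_fst[OF ch parity_ok_ground] by (simp add: chain_size_step_iff)
      then have "sorted_list_of_multiset (mset (map fst ps)) = map fst ps"
        by (metis sorted_list_of_multiset_mset sorted_sort_id)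
      then show "g (f ps) = ps"
        using colouring_map_fst[OF ch parity_ok_ground] by (simp add: f_def g_def del: mset_map)
    qed
    have *: "chain size_step 0 (sorted_list_of_multiset R)" if "(R, S) \<in> coloured_msets n k" for R S
      using that by (auto simp: chain_size_step_iff coloured_msets_def)
    show "\<forall>x\<in>coloured_msets n k. f (g x) = x"
    proof
      fix x assume x: "x \<in> coloured_msets n k"
      obtain R S where xx: "x = (R, S)" by (cases x)
      have "exits_to_c ?g (g x) = S"
        using x xx exits_to_c_colouring[of ?g "sorted_list_of_multiset R" S] * parity_ok_ground
        by (auto simp: g_def coloured_msets_def)
      then show "f (g x) = x" by (simp add: f_def g_def xx del: mset_map)
    qed
    show "f ` P_a n k \<subseteq> coloured_msets n k"
    proof (rule image_subsetI)
      fix ps assume ps: "ps \<in> P_a n k"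
      then have ch: "chain step ?g ps" by (simp add: P_a_def grounded_partition_iff_chain)
      have pos: "0 \<notin> fst ` set ps" using ps by (auto simp: P_a_def grounded_partition_iff_chain)
      have "\<forall>r\<in>fst ` set ps. \<forall>e. even e \<longrightarrow> 0 < e \<longrightarrow> e < r \<longrightarrow> e \<in> fst ` set ps"
        using chain_map_fst[OF ch parity_ok_ground] by (simp add: chain_size_step_iff)
      moreover have "exits_to_c ?g ps \<subseteq> {j. 2 * j + 1 \<in> fst ` set ps \<and> 2 * j + 2 \<in> fst ` set ps}"
        using exits_to_c_subset[OF ch parity_ok_ground] by fastforce
      ultimately show "f ps \<in> coloured_msets n k"
        using ps pos by (simp add: f_def coloured_msets_def P_a_def weight_eq num_odd_parts_eq)
    qed
    show "g ` coloured_msets n k \<subseteq> P_a n k"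
    proof (rule image_subsetI)
      fix x assume x: "x \<in> coloured_msets n k"
      obtain R S where xx: "x = (R, S)" by (cases x)
      have m: "map fst (g x) = sorted_list_of_multiset R" by (simp add: g_def xx)
      have "fst ` set (g x) = set_mset R" using m by (metis list.set_map set_sorted_list_of_multiset)
      moreover have "0 \<notin># R" using x xx by (simp add: coloured_msets_def)
      ultimately have "\<forall>q\<in>set (g x). 0 < fst q" by (metis image_eqI gr0I)
      moreover have "chain step ?g (g x)"
        using chain_colouring[of ?g "sorted_list_of_multiset R" S] * x xx parity_ok_ground by (simp add: g_def)
      ultimately show "g x \<in> P_a n k"
        using x[unfolded xx] by (simp add: P_a_def grounded_partition_iff_chain weight_eq num_odd_parts_eq m coloured_msets_def del: mset_map)
    qed
  qed
  then show ?thesis by (auto simp: eqpoll_def)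
qed

section \<open>Separation of parts by parity, and assembly of the bijection\<close>

definition join :: "nat multiset \<Rightarrow> nat multiset \<Rightarrow> nat multiset" where
  "join E A = image_mset (\<lambda>i. 2 * i) E + image_mset (\<lambda>j. 2 * j + 1) A"

lemma count_join [simp]: "count (join E A) (2 * i) = count E i"
proof -
  have "count (image_mset (\<lambda>i. 2 * i) E) (2 * i) = count E i" by (induction E) auto
  moreover have "count (image_mset (\<lambda>j. 2 * j + 1) A) (2 * i) = 0"
    by (induction A) (auto, presburger)
  ultimately show ?thesis by (simp add: join_def)
qed

lemma even_in_join [simp]: "2 * i \<in># join E A \<longleftrightarrow> i \<in># E"
  by (simp flip: count_greater_zero_iff)

lemma odd_in_join [simp]: "Suc (2 * j) \<in># join E A \<longleftrightarrow> j \<in># A"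
proof -
  have "Suc (2 * j) \<noteq> 2 * i" for i by presburger
  then show ?thesis by (auto simp: join_def)
qed

lemma sum_mset_join: "sum_mset (join E A) = 2 * (sum_mset E + sum_mset A) + size A"
proof -
  have "sum_mset (image_mset (\<lambda>i. 2 * i) E) = 2 * sum_mset E" by (induction E) auto
  moreover have "sum_mset (image_mset (\<lambda>j. 2 * j + 1) A) = 2 * sum_mset A + size A" by (induction A) auto
  ultimately show ?thesis by (simp add: join_def)
qed

lemma filter_odd_join: "filter_mset odd (join E A) = image_mset (\<lambda>j. 2 * j + 1) A"
  by (simp add: join_def filter_mset_image_mset)

lemma filter_even_join: "filter_mset even (join E A) = image_mset (\<lambda>i. 2 * i) E"
  by (simp add: join_def filter_mset_image_mset)

lemma join_eq_iff: "join E A = join F B \<longleftrightarrow> E = F \<and> A = B"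
proof
  assume eq: "join E A = join F B"
  have E: "image_mset (\<lambda>x. x div 2) (filter_mset even (join E A)) = E"
    and A: "image_mset (\<lambda>x. x div 2) (filter_mset odd (join E A)) = A" for E A
    unfolding filter_even_join filter_odd_join by (simp_all add: multiset.map_comp comp_def)
  show "E = F \<and> A = B" using E A eq by metis
qed simp

lemma join_cases:
  obtains E A where "R = join E A"
proof -
  have "R = image_mset (\<lambda>x. 2 * (x div 2)) (filter_mset even R)
      + image_mset (\<lambda>x. 2 * (x div 2) + 1) (filter_mset odd R)"
    by (induction R) auto
  then have "R = join (image_mset (\<lambda>x. x div 2) (filter_mset even R)) (image_mset (\<lambda>x. x div 2) (filter_mset odd R))"
    by (simp add: join_def multiset.map_comp comp_def)
  then show thesis using that by blast
qed

lemma downward_closed_eq_interval: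
  fixes X :: "nat set"
  assumes "finite X" "0 \<notin> X" "\<And>x y. x \<in> X \<Longrightarrow> 0 < y \<Longrightarrow> y < x \<Longrightarrow> y \<in> X"
  shows "\<exists>M. X = {1..M}"
proof (cases "X = {}")
  case False
  have "x \<in> X" if "x \<in> {1..Max X}" for x
    using that assms(3)[of "Max X" x] Max_in[OF assms(1) False] by (cases "x = Max X") auto
  moreover have "x \<in> {1..Max X}" if "x \<in> X" for x
    using that assms(1,2) by (auto simp: Suc_le_eq intro: gr0I)
  ultimately show ?thesis by blast
qed auto

text \<open>The gap condition makes \<open>E\<close> an interval \<open>{1..M}\<close>. Below an odd
  part \<open>2 * j + 1\<close> with \<open>j > 0\<close> it demands the part \<open>2 * j\<close>,
  whence \<open>j \<le> M\<close>; a mark on \<open>j\<close> demands \<open>2 * j + 2\<close>,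
  whence \<open>j < M\<close>.\<close>

lemma coloured_msets_eq:
  "coloured_msets (2 * h + k) k = (\<lambda>(M, E, A, S). (join E A, S)) ` profiles h k"
proof (intro equalityI subsetI)
  fix x assume x: "x \<in> coloured_msets (2 * h + k) k"
  obtain R S where xx: "x = (R, S)" by (cases x)
  obtain E A where R: "R = join E A" by (rule join_cases)
  have all: "\<forall>r\<in>#R. \<forall>e. even e \<longrightarrow> 0 < e \<longrightarrow> e < r \<longrightarrow> e \<in># R"
    and S: "S \<subseteq> {j. 2 * j + 1 \<in># R \<and> 2 * j + 2 \<in># R}"
    and zero: "0 \<notin># R" and sum: "sum_mset R = 2 * h + k" and odd: "size (filter_mset odd R) = k"
    using x by (auto simp: xx coloured_msets_def)
  have gap: "i \<in># E" if "r \<in># R" "0 < i" "2 * i < r" for r i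
    using all[rule_format, of r "2 * i"] that by (simp add: R)
  have "\<exists>M. set_mset E = {1..M}"
  proof (rule downward_closed_eq_interval)
    show "0 \<notin># E" using zero even_in_join[of 0 E A] by (simp add: R)
    show "y \<in># E" if "x \<in># E" "0 < y" "y < x" for x y
      using gap[of "2 * x" y] that by (simp add: R)
  qed simp
  then obtain M where M: "set_mset E = {1..M}" ..
  have "j \<le> M" if "j \<in># A" for j
    using gap[of "Suc (2 * j)" j] that M by (cases "j = 0") (auto simp: R)
  moreover have "j \<in># A \<and> j < M" if "j \<in> S" for j
  proof -
    have "Suc (2 * j) \<in># R" "2 * Suc j \<in># R" using S that by auto
    then show ?thesis unfolding R odd_in_join even_in_join using M by auto
  qed
  moreover have "size A = k" "sum_mset E + sum_mset A = h"
    using sum odd by (simp_all add: R filter_odd_join sum_mset_join)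
  ultimately have "(M, E, A, S) \<in> profiles h k" using M by (auto simp: profiles_def)
  then show "x \<in> (\<lambda>(M, E, A, S). (join E A, S)) ` profiles h k" using xx R by force
next
  fix x assume "x \<in> (\<lambda>(M, E, A, S). (join E A, S)) ` profiles h k"
  then obtain M E A S where x: "x = (join E A, S)" and W: "set_mset E = {1..M}" "set_mset A \<subseteq> {..M}"
    "S \<subseteq> set_mset A" "S \<subseteq> {..<M}" "sum_mset E + sum_mset A = h" "size A = k"
    by (auto simp: profiles_def)
  have "e \<in># join E A" if "r \<in># join E A" "even e" "0 < e" "e < r" for r e
  proof -
    obtain i where i: "e = 2 * i" using \<open>even e\<close> by (auto elim: evenE)
    have "r \<le> 2 * M + 1" using that W(1,2) by (auto simp: join_def)
    then show ?thesis using that i W(1) by simp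
  qed
  moreover have "0 \<notin># join E A" using even_in_join[of 0 E A] W(1) by simp
  moreover have "2 * j + 1 \<in># join E A \<and> 2 * j + 2 \<in># join E A" if "j \<in> S" for j
    using that W even_in_join[of "Suc j" E A] by auto
  ultimately show "x \<in> coloured_msets (2 * h + k) k"
    using W by (auto simp: x coloured_msets_def filter_odd_join sum_mset_join)
qed

lemma coloured_msets_eqpoll: "coloured_msets (2 * h + k) k \<approx> profiles h k"
  unfolding coloured_msets_eq
proof (rule inj_on_image_eqpoll_self, rule inj_onI)
  fix x y assume xy: "x \<in> profiles h k" "y \<in> profiles h k"
    and eq: "(\<lambda>(M, E, A, S). (join E A, S)) x = (\<lambda>(M, E, A, S). (join E A, S)) y"
  obtain M E A S where x: "x = (M, E, A, S)" by (cases x)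
  obtain N F B T where y: "y = (N, F, B, T)" by (cases y)
  \<comment> \<open>\<open>M\<close> is the number of distinct even parts, so \<open>E\<close>
    determines it.\<close>
  have "M = card (set_mset E)" using xy(1) by (simp add: x profiles_def)
  moreover have "N = card (set_mset F)" using xy(2) by (simp add: y profiles_def)
  ultimately show "x = y" using eq by (simp add: x y join_eq_iff)
qed

lemma E_set_eq: "E_set (2 * h + k) k = (\<lambda>(D, A). join (mset_set D) A) ` splits h k"
proof (intro equalityI subsetI)
  fix R assume R: "R \<in> E_set (2 * h + k) k"
  obtain E A where EA: "R = join E A" by (rule join_cases)
  have "count E i \<le> 1" for i
  proof (cases "2 * i \<in># R")
    case True
    then have "count R (2 * i) = 1" using R by (simp add: E_set_def)
    then show ?thesis by (simp add: EA)
  next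
    case False
    then show ?thesis by (simp add: EA not_in_iff)
  qed
  then have E: "E = mset_set (set_mset E)"
    by (intro multiset_eqI) (metis count_eq_zero_iff count_mset_set(1,3) finite_set_mset le_antisym count_greater_eq_one_iff)
  have "0 \<notin># E" using R even_in_join[of 0 E A] by (auto simp: EA E_set_def is_partition_def)
  moreover have "size A = k" "sum_mset E + sum_mset A = h"
    using R by (auto simp: EA E_set_def is_partition_def filter_odd_join sum_mset_join)
  ultimately have "(set_mset E, A) \<in> splits h k"
    using E by (auto simp: splits_def sum_unfold_sum_mset)
  then show "R \<in> (\<lambda>(D, A). join (mset_set D) A) ` splits h k" using E EA by force
next
  fix R assume "R \<in> (\<lambda>(D, A). join (mset_set D) A) ` splits h k"
  then obtain D A where R: "R = join (mset_set D) A"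
    and V: "finite D" "0 \<notin> D" "\<Sum>D + sum_mset A = h" "size A = k"
    by (auto simp: splits_def)
  have "0 < r" if "r \<in># R" for r using that V by (auto simp: R join_def intro: gr0I)
  moreover have "count R r = 1" if "r \<in># R" "even r" for r
  proof -
    obtain i where i: "r = 2 * i" using \<open>even r\<close> by (auto elim: evenE)
    then show ?thesis using that(1) V by (simp add: R)
  qed
  moreover have "sum_mset (mset_set D) = \<Sum>D" by (simp add: sum_unfold_sum_mset)
  ultimately show "R \<in> E_set (2 * h + k) k"
    using V by (simp add: E_set_def is_partition_def R filter_odd_join sum_mset_join)
qed

lemma E_set_eqpoll: "E_set (2 * h + k) k \<approx> splits h k"
  unfolding E_set_eq
proof (rule inj_on_image_eqpoll_self, rule inj_onI)
  fix x y assume xy: "x \<in> splits h k" "y \<in> splits h k"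
    and eq: "(\<lambda>(D, A). join (mset_set D) A) x = (\<lambda>(D, A). join (mset_set D) A) y"
  obtain D A where x: "x = (D, A)" by (cases x)
  obtain C B where y: "y = (C, B)" by (cases y)
  have "finite D" "finite C" using xy by (simp_all add: x y splits_def)
  then show "x = y" using eq by (simp add: x y join_eq_iff)
qed

text \<open>The weight exceeds the number of odd parts by an even amount. Hence
  \<open>P_a n k\<close> and \<open>E_set n k\<close> are both empty unless
  \<open>n = 2 * h + k\<close>, the case covered by profiles and splits.\<close>

lemma sum_mset_parity:
  obtains h where "sum_mset R = 2 * h + size (filter_mset odd R)"
proof -
  obtain E A where "R = join E A" by (rule join_cases)
  then show thesis using that[of "sum_mset E + sum_mset A"] by (simp add: filter_odd_join sum_mset_join)
qed

lemma P_a_eqpoll_E_set: "P_a n k \<approx> E_set n k"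
proof (cases "\<exists>h. n = 2 * h + k")
  case True
  then obtain h where n: "n = 2 * h + k" ..
  have "P_a n k \<approx> profiles h k"
    unfolding n by (rule eqpoll_trans[OF P_a_eqpoll_coloured_msets coloured_msets_eqpoll])
  also have "\<dots> \<approx> splits h k" by (rule profiles_eqpoll_splits)
  also have "\<dots> \<approx> E_set n k" unfolding n by (rule eqpoll_sym[OF E_set_eqpoll])
  finally show ?thesis .
next
  case False
  have no: "\<not> (sum_mset R = n \<and> size (filter_mset odd R) = k)" for R
    using False sum_mset_parity[of R] by metis
  have "P_a n k = {}"
    using no by (auto simp: P_a_def weight_eq num_odd_parts_eq simp del: mset_map)
  moreover have "E_set n k = {}" using no by (auto simp: E_set_def is_partition_def)
  ultimately show ?thesis by simp
qed

theorem theorem1p15: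
  fixes n k :: nat
  assumes "k \<le> n"
  shows "(\<exists>f. bij_betw f (P_a n k) (E_set n k)) \<and> card (P_a n k) = card (E_set n k)"
  using P_a_eqpoll_E_set[of n k] by (auto simp: eqpoll_def intro: bij_betw_same_card)

end
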